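(* Let $r_1, \ldots,r_k \in \mathbb{Z}_{\ge 0}$ and $w = (w_1,\ldots,w_k) \in \mathbb{Z}_{\ge 1}^k$ with $w_1 = 1$ and $r_1 = 0$, ordered so that $r_1/w_1 \le r_2/w_2 \le \cdots \le r_k/w_k$. Let $W = \max\{w_1,\ldots,w_k\}$, $R = \max\{r_1,\ldots,r_k\}$, $S = \langle r_2,\ldots,r_k\rangle$, $d = \gcd(S)$, and $P_n = \langle n, w_2 n + r_2, \ldots, w_k n + r_k\rangle$. If $n > W R^2$, then $$\operatorname{Ap}(P_n; n) = \{i + \mathsf{m}_{S,w}(i)\, n \mid i \in \operatorname{Ap}(S; dn)\}.$$ Moreover, $\mathsf{L}_{P_n,w}(i + \mathsf{m}_{S,w}(i)\,n) = \{\mathsf{m}_{S,w}(i)\}$ for each $i \in \operatorname{Ap}(S; dn)$.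
   Context: Here $n$ is an integer, and $\langle g_1,\ldots,g_s\rangle = \{\sum z_i g_i : z_i \in \mathbb{Z}_{\ge 0}\}$ is the additive semigroup generated by $g_1,\ldots,g_s$ (not required to have finite complement in $\mathbb{Z}_{\ge 0}$); $\gcd(S) = \gcd(r_2,\ldots,r_k)$. For an additive subsemigroup $T \subset \mathbb{Z}_{\ge 0}$ and $m \in T$, the Apéry set is $\operatorname{Ap}(T; m) = \{t \in T : t - m \in \mathbb{Z}\setminus T\}$. For $i \in S$, $\mathsf{m}_{S,w}(i)$ is the minimum of $w_2 z_2 + \cdots + w_k z_k$ over all $(z_2,\ldots,z_k) \in \mathbb{Z}_{\ge 0}^{k-1}$ with $z_2 r_2 + \cdots + z_k r_k = i$. For $a \in P_n$, $\mathsf{L}_{P_n,w}(a)$ is the set of values $w_1 z_1 + \cdots + w_k z_k$ over all $z \in \mathbb{Z}_{\ge 0}^k$ with $a = z_1 n + \sum_{j=2}^k z_j(w_j n + r_j)$.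
   Formalization: Two hypotheses are added: d > 0 (some r_j is nonzero) and gcd(n, d) = 1; without them the claim is false, e.g. for k = 2, w = (1,1), r = (0,2), n = 100, where 5100 = 51·100 = 50·102. *)

theory Defs
  imports Complex_Main
begin

text \<open>The additive semigroup generated by a family \<open>g\<close> over a finite index set \<open>I\<close>
  (generators may be repeated or zero).\<close>

definition gen_semigroup :: "'i set \<Rightarrow> ('i \<Rightarrow> nat) \<Rightarrow> nat set" where
  "gen_semigroup I g = {\<Sum>i\<in>I. z i * g i | z :: 'i \<Rightarrow> nat. True}"

text \<open>The difference \<open>t - m\<close> is taken in the integers, so it may be negative.\<close>

definition Apery :: "nat set \<Rightarrow> nat \<Rightarrow> nat set" where
  "Apery T m = {t \<in> T. int t - int m \<notin> int ` T}"

text \<open>Below, \<open>r 1, \<dots>, r k\<close> and \<open>w 1, \<dots>, w k\<close> are the parameters; values of \<open>r\<close>, \<open>w\<close>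
  and \<open>z\<close> outside \<open>{1..k}\<close> play no role.\<close>

definition S_sg :: "nat \<Rightarrow> (nat \<Rightarrow> nat) \<Rightarrow> nat set" where
  "S_sg k r = gen_semigroup {2..k} r"

definition P_sg :: "nat \<Rightarrow> (nat \<Rightarrow> nat) \<Rightarrow> (nat \<Rightarrow> nat) \<Rightarrow> nat \<Rightarrow> nat set" where
  "P_sg k w r n = gen_semigroup {1..k} (\<lambda>j. if j = 1 then n else w j * n + r j)"

text \<open>The minimal weighted factorization length in \<open>S\<close>; only meaningful for \<open>i \<in> S_sg k r\<close>.
  The set of lengths may be infinite (some \<open>r j\<close> may be \<open>0\<close>), so \<open>Min\<close> is not suitable.\<close>

definition min_wlen :: "nat \<Rightarrow> (nat \<Rightarrow> nat) \<Rightarrow> (nat \<Rightarrow> nat) \<Rightarrow> nat \<Rightarrow> nat" where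
  "min_wlen k w r i =
     (LEAST l. \<exists>z :: nat \<Rightarrow> nat. l = (\<Sum>j=2..k. w j * z j) \<and> (\<Sum>j=2..k. z j * r j) = i)"

definition wlen_set :: "nat \<Rightarrow> (nat \<Rightarrow> nat) \<Rightarrow> (nat \<Rightarrow> nat) \<Rightarrow> nat \<Rightarrow> nat \<Rightarrow> nat set" where
  "wlen_set k w r n a =
     {\<Sum>j=1..k. w j * z j | z :: nat \<Rightarrow> nat. a = z 1 * n + (\<Sum>j=2..k. z j * (w j * n + r j))}"

end

theory Submission
  imports Defs "HOL-Number_Theory.Cong"
begin

text \<open>
  Write \<open>m(i)\<close> for the minimal weighted length \<open>min_wlen k w r i\<close>.  Collecting the multiples of
  \<open>n\<close> in a factorization \<open>z\<close> of an element of \<open>P\<close> turns it into \<open>i + l * n\<close>, where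
  \<open>i = \<Sum>j\<ge>2. z j * r j\<close> lies in \<open>S\<close> and \<open>l\<close> is the weighted length of \<open>z\<close>.  The coefficient of
  \<open>n\<close> itself, which has weight 1, can absorb any excess, so the pairs \<open>(i, l)\<close> that occur are exactly
  those with \<open>i \<in> S\<close> and \<open>l \<ge> m(i)\<close> (\<open>wlen_set_iff\<close>, \<open>P_sg_iff\<close>).  Everything thus reduces to
  comparing different pairs with the same value \<open>i + l * n\<close>.

  The generator \<open>r k\<close> is the most efficient one, as it has the largest ratio \<open>r j / w j\<close>.  Hence
  \<open>m(i) \<ge> i * w k / r k\<close>.  Conversely, \<open>m(i)\<close> exceeds this bound by at most \<open>W * r k\<close>: among any
  \<open>r k\<close> generators some nonempty subcollection has a sum divisible by \<open>r k\<close> (pigeonhole on partial sums),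
  so fewer than \<open>r k\<close> generators together with copies of \<open>r k\<close> suffice to write \<open>i\<close>.  As
  \<open>n > W * R\<^sup>2\<close>, these two bounds show that \<open>m(i) < m(i')\<close> whenever \<open>i, i' \<in> S\<close> and \<open>i' \<ge> i + n\<close>
  (\<open>min_wlen_less\<close>).  The same reduction, applied to a Bezout representation of \<open>d * n\<close>, shows
  that \<open>d * n \<in> S\<close> (\<open>large_multiple_in_S\<close>).

  Suppose now that \<open>i + m(i) * n = i' + l * n\<close> with \<open>i\<close> in the Apery set of \<open>S\<close> and \<open>l \<ge> m(i')\<close>.
  If \<open>i' > i\<close>, then \<open>i' \<ge> i + n\<close> and so \<open>l \<ge> m(i') > m(i)\<close>, which is absurd.  If \<open>i' < i\<close>, then
  \<open>i - i'\<close> is divisible by the coprime numbers \<open>n\<close> and \<open>d\<close>, hence by \<open>d * n\<close>, and \<open>d * n \<in> S\<close> gives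
  \<open>i - d * n \<in> S\<close>, again absurd.  So \<open>i' = i\<close> and \<open>l = m(i)\<close>: the length is unique and the element is
  in the Apery set of \<open>P\<close>.  Conversely, an element of the Apery set of \<open>P\<close> has the form
  \<open>i + m(i) * n\<close>, and if \<open>i' = i - d * n\<close> were in \<open>S\<close>, then the rewriting
  \<open>i' + (m(i) + d) * n\<close> together with \<open>m(i') < m(i)\<close> would leave room to subtract \<open>n\<close>.
\<close>

section \<open>Short representatives of sums modulo an integer\<close>

text \<open>A factorization is built up one generator at a time, which provides the partial sums for the
  pigeonhole argument.\<close>

lemma exists_unit_step_chain:
  fixes z :: "'a \<Rightarrow> nat"
  assumes "finite I" "sum z I = N"
  shows "\<exists>f. (\<forall>t\<le>N. sum (f t) I = t) \<and> (\<forall>s t j. s \<le> t \<and> t \<le> N \<and> j \<in> I \<longrightarrow> f s j \<le> (f t j :: nat)) \<and> f N = z"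
  using assms(2)
proof (induction N arbitrary: z)
  case 0
  then show ?case by (intro exI[of _ "\<lambda>_. z"]) auto
next
  case (Suc N)
  then obtain i where i: "i \<in> I" "z i > 0"
    by (metis gr0I nat.distinct(1) sum.neutral)
  define z' where "z' = z(i := z i - 1)"
  have "sum z I = z i + sum z (I - {i})" "sum z' I = z' i + sum z' (I - {i})"
    using assms(1) i by (auto simp: sum.remove)
  moreover have "sum z' (I - {i}) = sum z (I - {i})"
    by (rule sum.cong) (auto simp: z'_def)
  ultimately have "sum z' I = N" using Suc.prems i by (simp add: z'_def)
  from Suc.IH[OF this] obtain f where f: "\<And>t. t \<le> N \<Longrightarrow> sum (f t) I = t"
    "\<And>s t j. s \<le> t \<Longrightarrow> t \<le> N \<Longrightarrow> j \<in> I \<Longrightarrow> f s j \<le> f t j" "f N = z'" by blast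
  have z': "z' j \<le> z j" for j by (simp add: z'_def)
  have "f s j \<le> z j" if "s \<le> N" "j \<in> I" for s j
    using f(2)[of s N j] f(3) z'[of j] that by simp
  then show ?case
    using f Suc.prems
    by (intro exI[of _ "f(Suc N := z)"]) (auto simp: le_Suc_eq)
qed

text \<open>Two of the \<open>m + 1\<close> first partial sums agree modulo \<open>m\<close>; the generators added between them can
  be dropped.  Iterating this leaves fewer than \<open>m\<close> generators.\<close>

lemma short_representative_mod:
  fixes z r :: "'a \<Rightarrow> nat"
  assumes fin: "finite I" and m: "m > 0"
  shows "\<exists>y. sum y I < m \<and> (\<Sum>j\<in>I. y j * r j) \<le> (\<Sum>j\<in>I. z j * r j) \<and>
             [(\<Sum>j\<in>I. y j * r j) = (\<Sum>j\<in>I. z j * r j)] (mod m)"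
proof (induction "sum z I" arbitrary: z rule: less_induct)
  case less
  show ?case
  proof (cases "sum z I < m")
    case True
    then show ?thesis by (intro exI[of _ z]) auto
  next
    case False
    obtain f where f: "\<And>t. t \<le> sum z I \<Longrightarrow> sum (f t) I = t"
      "\<And>s t j. s \<le> t \<Longrightarrow> t \<le> sum z I \<Longrightarrow> j \<in> I \<Longrightarrow> f s j \<le> f t j" "f (sum z I) = z"
      using exists_unit_step_chain[OF fin refl, of z] by blast
    define v where "v t = (\<Sum>j\<in>I. f t j * r j)" for t
    have "card ((\<lambda>t. v t mod m) ` {..m}) < card {..m}"
    proof -
      have "(\<lambda>t. v t mod m) ` {..m} \<subseteq> {..<m}" using m by auto
      from card_mono[OF _ this] show ?thesis by simp
    qed
    then have "\<not> inj_on (\<lambda>t. v t mod m) {..m}" by (rule pigeonhole)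
    then obtain s t where st: "s < t" "t \<le> m" "v s mod m = v t mod m"
      unfolding inj_on_def by (metis atMost_iff linorder_neqE_nat)
    have tz: "t \<le> sum z I" using st False by simp
    define y where "y j = z j - (f t j - f s j)" for j
    have fz: "f s j \<le> f t j" "f t j \<le> z j" if "j \<in> I" for j
      using f(2)[of s t j] f(2)[of t "sum z I" j] f(3) st tz that by auto
    have y: "y j + f t j = z j + f s j" if "j \<in> I" for j
      using fz[OF that] by (simp add: y_def)
    have "sum y I + sum (f t) I = sum z I + sum (f s) I"
      unfolding sum.distrib[symmetric] by (rule sum.cong) (simp_all add: y)
    then have "sum y I < sum z I" using f(1)[of s] f(1)[of t] st tz by simp
    moreover have *: "(\<Sum>j\<in>I. y j * r j) + v t = (\<Sum>j\<in>I. z j * r j) + v s"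
      unfolding v_def sum.distrib[symmetric] add_mult_distrib[symmetric]
      by (rule sum.cong) (simp_all add: y)
    moreover have "(\<Sum>j\<in>I. y j * r j) \<le> (\<Sum>j\<in>I. z j * r j)"
      by (rule sum_mono) (simp add: y_def)
    moreover have "[(\<Sum>j\<in>I. y j * r j) = (\<Sum>j\<in>I. z j * r j)] (mod m)"
    proof -
      have "[(\<Sum>j\<in>I. y j * r j) + v t = (\<Sum>j\<in>I. z j * r j) + v t] (mod m)"
        unfolding * using st(3) by (intro cong_add) (auto simp: cong_def)
      then show ?thesis by (simp add: cong_add_rcancel_nat)
    qed
    ultimately show ?thesis
      using less.hyps[of y] by (meson cong_trans order_trans)
  qed
qed

lemma Gcd_eq_int_combination:
  fixes r :: "'a \<Rightarrow> nat"
  assumes "finite I"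
  shows "\<exists>u :: 'a \<Rightarrow> int. (\<Sum>j\<in>I. u j * int (r j)) = int (Gcd (r ` I))"
  using assms
proof (induction I rule: finite_induct)
  case empty
  then show ?case by simp
next
  case (insert i I)
  then obtain u :: "'a \<Rightarrow> int" where u: "(\<Sum>j\<in>I. u j * int (r j)) = int (Gcd (r ` I))" by blast
  obtain a b where ab: "a * int (r i) + b * int (Gcd (r ` I)) = gcd (int (r i)) (int (Gcd (r ` I)))"
    using bezout_int by blast
  define u' where "u' j = (if j = i then a else b * u j)" for j
  have "(\<Sum>j\<in>I. u' j * int (r j)) = (\<Sum>j\<in>I. b * (u j * int (r j)))"
    using insert.hyps by (intro sum.cong) (auto simp: u'_def)
  also have "\<dots> = b * int (Gcd (r ` I))" by (simp add: u flip: sum_distrib_left)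
  finally have "(\<Sum>j\<in>insert i I. u' j * int (r j)) = gcd (int (r i)) (int (Gcd (r ` I)))"
    using insert.hyps ab by (simp add: u'_def)
  then show ?case by (auto simp: gcd_int_int_eq)
qed

lemma multiple_of_Gcd_cong_nat_combination:
  fixes r :: "'a \<Rightarrow> nat"
  assumes "finite I" "m > 0"
  shows "\<exists>z :: 'a \<Rightarrow> nat. [(\<Sum>j\<in>I. z j * r j) = Gcd (r ` I) * n] (mod m)"
proof -
  obtain u :: "'a \<Rightarrow> int" where u: "(\<Sum>j\<in>I. u j * int (r j)) = int (Gcd (r ` I))"
    using Gcd_eq_int_combination[OF assms(1), of r] by blast
  define z where "z j = nat ((int n * u j) mod int m)" for j
  have z: "int (z j) = (int n * u j) mod int m" for j using assms(2) by (simp add: z_def)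
  have "[(\<Sum>j\<in>I. int (z j) * int (r j)) = (\<Sum>j\<in>I. (int n * u j) * int (r j))] (mod int m)"
    by (intro cong_sum cong_mult) (auto simp: z)
  also have "(\<Sum>j\<in>I. (int n * u j) * int (r j)) = int n * (\<Sum>j\<in>I. u j * int (r j))"
    by (simp add: sum_distrib_left mult.assoc)
  also have "\<dots> = int (Gcd (r ` I) * n)" by (simp add: u)
  finally have "[int (\<Sum>j\<in>I. z j * r j) = int (Gcd (r ` I) * n)] (mod int m)" by simp
  then show ?thesis unfolding cong_int_iff by blast
qed

section \<open>Minimal weighted lengths\<close>

lemma S_sg_iff: "i \<in> S_sg k r \<longleftrightarrow> (\<exists>z. (\<Sum>j=2..k. z j * r j) = i)"
  by (auto simp: S_sg_def gen_semigroup_def)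

lemma S_sg_add:
  assumes "a \<in> S_sg k r" "b \<in> S_sg k r"
  shows "a + b \<in> S_sg k r"
proof -
  obtain x y where "(\<Sum>j=2..k. x j * r j) = a" "(\<Sum>j=2..k. y j * r j) = b"
    using assms by (auto simp: S_sg_iff)
  then have "(\<Sum>j=2..k. (x j + y j) * r j) = a + b" by (simp add: add_mult_distrib sum.distrib)
  then show ?thesis unfolding S_sg_iff by (intro exI[of _ "\<lambda>j. x j + y j"])
qed

lemma S_sg_add_multiple: "a \<in> S_sg k r \<Longrightarrow> b \<in> S_sg k r \<Longrightarrow> a + t * b \<in> S_sg k r"
  by (induction t) (auto dest: S_sg_add[of _ k r b] simp: algebra_simps)

lemma Gcd_dvd_S_sg: "i \<in> S_sg k r \<Longrightarrow> Gcd (r ` {2..k}) dvd i"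
  unfolding S_sg_iff by (force intro: dvd_sum dvd_mult Gcd_dvd)

lemma min_wlen_attained:
  assumes "i \<in> S_sg k r"
  obtains z where "min_wlen k w r i = (\<Sum>j=2..k. w j * z j)" "(\<Sum>j=2..k. z j * r j) = i"
proof -
  have "\<exists>l z. l = (\<Sum>j=2..k. w j * z j) \<and> (\<Sum>j=2..k. z j * r j) = i"
    using assms by (auto simp: S_sg_iff)
  from LeastI_ex[OF this] show ?thesis using that unfolding min_wlen_def by blast
qed

lemma min_wlen_le: "(\<Sum>j=2..k. z j * r j) = i \<Longrightarrow> min_wlen k w r i \<le> (\<Sum>j=2..k. w j * z j)"
  unfolding min_wlen_def by (rule Least_le) blast

text \<open>In an element of \<open>P\<close> only the pair (element of \<open>S\<close>, weighted length) matters: the generator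
  \<open>n\<close> has weight 1 and makes up the difference between the weighted length and the minimal one.\<close>

lemma wlen_set_iff:
  assumes "k \<ge> 1" "w 1 = 1"
  shows "l \<in> wlen_set k w r n a \<longleftrightarrow> (\<exists>i \<in> S_sg k r. min_wlen k w r i \<le> l \<and> a = i + l * n)"
proof
  have split: "(\<Sum>j=1..k. w j * z j) = z 1 + (\<Sum>j=2..k. w j * z j)" for z :: "nat \<Rightarrow> nat"
    using assms by (simp add: sum.atLeast_Suc_atMost numeral_2_eq_2)
  have expand: "z 1 * n + (\<Sum>j=2..k. z j * (w j * n + r j)) =
      (\<Sum>j=2..k. z j * r j) + (z 1 + (\<Sum>j=2..k. w j * z j)) * n" for z :: "nat \<Rightarrow> nat"
    by (simp add: algebra_simps sum.distrib sum_distrib_left sum_distrib_right)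
  {
    assume "l \<in> wlen_set k w r n a"
    then obtain z where z: "l = z 1 + (\<Sum>j=2..k. w j * z j)" "a = (\<Sum>j=2..k. z j * r j) + l * n"
      unfolding wlen_set_def split expand by blast
    then show "\<exists>i \<in> S_sg k r. min_wlen k w r i \<le> l \<and> a = i + l * n"
      using min_wlen_le[OF refl, of k w r z] by (intro bexI[of _ "\<Sum>j=2..k. z j * r j"]) (auto simp: S_sg_iff)
  next
    assume "\<exists>i \<in> S_sg k r. min_wlen k w r i \<le> l \<and> a = i + l * n"
    then obtain i where i: "i \<in> S_sg k r" "min_wlen k w r i \<le> l" "a = i + l * n" by blast
    obtain z where z: "min_wlen k w r i = (\<Sum>j=2..k. w j * z j)" "(\<Sum>j=2..k. z j * r j) = i"
      using min_wlen_attained[OF i(1)] .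
    define z' where "z' = z(1 := l - min_wlen k w r i)"
    have "(\<Sum>j=2..k. w j * z' j) = (\<Sum>j=2..k. w j * z j)" "(\<Sum>j=2..k. z' j * r j) = (\<Sum>j=2..k. z j * r j)"
      by (auto intro!: sum.cong simp: z'_def)
    then have "z' 1 + (\<Sum>j=2..k. w j * z' j) = l" "(\<Sum>j=2..k. z' j * r j) = i"
      using i(2) z by (auto simp: z'_def)
    then show "l \<in> wlen_set k w r n a"
      unfolding wlen_set_def split expand i(3) by (intro CollectI exI[of _ z']) simp
  }
qed

lemma P_sg_iff:
  assumes "k \<ge> 1" "w 1 = 1"
  shows "a \<in> P_sg k w r n \<longleftrightarrow> (\<exists>i \<in> S_sg k r. \<exists>l \<ge> min_wlen k w r i. a = i + l * n)"
proof -
  have "(\<Sum>j=1..k. z j * (if j = 1 then n else w j * n + r j)) =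
      z 1 * n + (\<Sum>j=2..k. z j * (w j * n + r j))" for z :: "nat \<Rightarrow> nat"
  proof -
    have "(\<Sum>j=1..k. z j * (if j = 1 then n else w j * n + r j)) =
        z 1 * n + (\<Sum>j=2..k. z j * (if j = 1 then n else w j * n + r j))"
      using assms by (simp add: sum.atLeast_Suc_atMost numeral_2_eq_2)
    also have "(\<Sum>j=2..k. z j * (if j = 1 then n else w j * n + r j)) =
        (\<Sum>j=2..k. z j * (w j * n + r j))"
      by (rule sum.cong) auto
    finally show ?thesis .
  qed
  then have "a \<in> P_sg k w r n \<longleftrightarrow> (\<exists>l. l \<in> wlen_set k w r n a)"
    unfolding P_sg_def gen_semigroup_def wlen_set_def by auto
  then show ?thesis by (auto simp: wlen_set_iff[of k w, OF assms])
qed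

text \<open>Filling up a partial sum \<open>y\<close> with copies of \<open>r k\<close> costs \<open>w k / r k\<close> per unit.  The result is
  used twice: the length bound for elements of \<open>S\<close>, and the membership for \<open>d * n\<close>, which is
  not known beforehand to lie in \<open>S\<close>.\<close>

lemma complete_by_last_generator:
  assumes k: "k \<ge> 2" and le: "(\<Sum>j=2..k. y j * r j) \<le> c"
    and cong: "[(\<Sum>j=2..k. y j * r j) = c] (mod r k)"
  shows "c \<in> S_sg k r" "r k * min_wlen k w r c \<le> r k * (\<Sum>j=2..k. w j * y j) + w k * c"
proof -
  have "r k dvd c - (\<Sum>j=2..k. y j * r j)"
    using cong le by (metis cong_altdef_nat cong_sym)
  then obtain q where q: "c = (\<Sum>j=2..k. y j * r j) + r k * q"
    using le by (metis dvdE le_add_diff_inverse)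
  define z where "z j = y j + (if j = k then q else 0)" for j
  have "(\<Sum>j=2..k. z j * r j) = (\<Sum>j=2..k. y j * r j + (if j = k then q * r k else 0))"
    by (rule sum.cong) (auto simp: z_def algebra_simps)
  then have z: "(\<Sum>j=2..k. z j * r j) = c" using k q by (simp add: sum.distrib)
  then show "c \<in> S_sg k r" by (auto simp: S_sg_iff)
  have "(\<Sum>j=2..k. w j * z j) = (\<Sum>j=2..k. w j * y j + (if j = k then w k * q else 0))"
    by (rule sum.cong) (auto simp: z_def algebra_simps)
  then have "(\<Sum>j=2..k. w j * z j) = (\<Sum>j=2..k. w j * y j) + w k * q"
    using k by (simp add: sum.distrib)
  then have "r k * min_wlen k w r c \<le> r k * ((\<Sum>j=2..k. w j * y j) + w k * q)"
    using min_wlen_le[OF z, of w] by (intro mult_le_mono) auto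
  also have "\<dots> = r k * (\<Sum>j=2..k. w j * y j) + w k * (r k * q)" by (simp add: algebra_simps)
  also have "\<dots> \<le> r k * (\<Sum>j=2..k. w j * y j) + w k * c" using q by simp
  finally show "r k * min_wlen k w r c \<le> r k * (\<Sum>j=2..k. w j * y j) + w k * c" .
qed

text \<open>Any factorization of \<open>i\<close> can be replaced by one with fewer than \<open>r k\<close> generators, each of
  weight at most \<open>W\<close>, plus copies of \<open>r k\<close>.\<close>

lemma min_wlen_upper:
  assumes "k \<ge> 2" "r k > 0" and i: "i \<in> S_sg k r" and W: "\<And>j. j \<in> {2..k} \<Longrightarrow> w j \<le> W"
  shows "r k * min_wlen k w r i \<le> W * r k ^ 2 + w k * i"
proof -
  obtain z where z: "(\<Sum>j=2..k. z j * r j) = i" using i by (auto simp: S_sg_iff)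
  obtain y where y: "sum y {2..k} < r k" "(\<Sum>j=2..k. y j * r j) \<le> i"
    "[(\<Sum>j=2..k. y j * r j) = i] (mod r k)"
    using short_representative_mod[of "{2..k}" "r k" r z] assms(2) unfolding z by auto
  have "(\<Sum>j=2..k. w j * y j) \<le> (\<Sum>j=2..k. W * y j)"
    by (intro sum_mono mult_le_mono1 W)
  also have "\<dots> = W * sum y {2..k}" by (simp add: sum_distrib_left)
  also have "\<dots> \<le> W * r k" using y(1) by simp
  finally have "r k * (\<Sum>j=2..k. w j * y j) \<le> r k * (W * r k)" by (rule mult_le_mono2)
  also have "\<dots> = W * r k ^ 2" by (simp add: power2_eq_square)
  finally show ?thesis
    using complete_by_last_generator(2)[OF assms(1) y(2,3), of w] by linarith
qed

lemma min_wlen_lower: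
  assumes i: "i \<in> S_sg k r" and ratio: "\<And>j. j \<in> {2..k} \<Longrightarrow> w k * r j \<le> r k * w j"
  shows "w k * i \<le> r k * min_wlen k w r i"
proof -
  obtain z where z: "min_wlen k w r i = (\<Sum>j=2..k. w j * z j)" "(\<Sum>j=2..k. z j * r j) = i"
    using min_wlen_attained[OF i] .
  have "w k * i = (\<Sum>j=2..k. (w k * r j) * z j)"
    unfolding z(2)[symmetric] by (simp add: sum_distrib_left algebra_simps)
  also have "\<dots> \<le> (\<Sum>j=2..k. (r k * w j) * z j)" by (intro sum_mono mult_le_mono1 ratio)
  also have "\<dots> = r k * min_wlen k w r i" unfolding z(1) by (simp add: sum_distrib_left algebra_simps)
  finally show ?thesis .
qed

text \<open>Once the gap between two elements exceeds the slack in the two preceding bounds, their minimal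
  lengths are ordered strictly.\<close>

lemma min_wlen_less:
  assumes "k \<ge> 2" "r k > 0" "w k > 0"
    and W: "\<And>j. j \<in> {2..k} \<Longrightarrow> w j \<le> W"
    and ratio: "\<And>j. j \<in> {2..k} \<Longrightarrow> w k * r j \<le> r k * w j"
    and n: "W * r k ^ 2 < n"
    and i: "i \<in> S_sg k r" "i' \<in> S_sg k r" "i + n \<le> i'"
  shows "min_wlen k w r i < min_wlen k w r i'"
proof -
  have "r k * min_wlen k w r i \<le> W * r k ^ 2 + w k * i"
    by (rule min_wlen_upper) (use assms in auto)
  also have "\<dots> < n + w k * i" using n by simp
  also have "\<dots> \<le> w k * (i + n)" using assms(3) by (simp add: algebra_simps)
  also have "\<dots> \<le> w k * i'" using i(3) by (rule mult_le_mono2)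
  also have "\<dots> \<le> r k * min_wlen k w r i'" by (rule min_wlen_lower) (use i ratio in auto)
  finally show ?thesis by simp
qed

text \<open>Bezout coefficients can be made nonnegative modulo \<open>r k\<close> at the price of a large sum; the
  short representative brings it below \<open>R\<^sup>2\<close>, so that only copies of \<open>r k\<close> remain to be added.\<close>

lemma large_multiple_in_S:
  assumes "k \<ge> 2" "r k > 0" and R: "\<And>j. j \<in> {2..k} \<Longrightarrow> r j \<le> R"
    and large: "R ^ 2 \<le> Gcd (r ` {2..k}) * n"
  shows "Gcd (r ` {2..k}) * n \<in> S_sg k r"
proof -
  let ?c = "Gcd (r ` {2..k}) * n"
  obtain z :: "nat \<Rightarrow> nat" where z: "[(\<Sum>j=2..k. z j * r j) = ?c] (mod r k)"
    using multiple_of_Gcd_cong_nat_combination[of "{2..k}" "r k" r n] assms(2) by auto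
  obtain y where y: "sum y {2..k} < r k"
    "[(\<Sum>j=2..k. y j * r j) = (\<Sum>j=2..k. z j * r j)] (mod r k)"
    using short_representative_mod[of "{2..k}" "r k" r z] assms(2) by auto
  have "(\<Sum>j=2..k. y j * r j) \<le> (\<Sum>j=2..k. y j * R)"
    by (intro sum_mono mult_le_mono2 R)
  also have "\<dots> = sum y {2..k} * R" by (simp add: sum_distrib_right)
  also have "\<dots> \<le> R * R" using y(1) R[of k] assms(1) by (intro mult_le_mono1) auto
  also have "\<dots> \<le> ?c" using large by (simp add: power2_eq_square)
  finally show ?thesis
    using complete_by_last_generator(1)[OF assms(1)] cong_trans[OF y(2) z] by blast
qed

section \<open>The Apery set\<close>

lemma Apery_iff: "t \<in> Apery T m \<longleftrightarrow> t \<in> T \<and> (\<forall>s\<in>T. t \<noteq> s + m)"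
proof -
  have "int t - int m = int s \<longleftrightarrow> t = s + m" for s by linarith
  then show ?thesis unfolding Apery_def by auto
qed

theorem theorem6p5:
  fixes k n d W R :: nat and r w :: "nat \<Rightarrow> nat" and S P :: "nat set"
  assumes k: "k \<ge> 1"
    and w_pos: "\<And>j. j \<in> {1..k} \<Longrightarrow> w j \<ge> 1"
    and w1: "w 1 = 1" and r1: "r 1 = 0"
    and ordered: "\<And>i j. 1 \<le> i \<Longrightarrow> i \<le> j \<Longrightarrow> j \<le> k \<Longrightarrow>
                    real (r i) / real (w i) \<le> real (r j) / real (w j)"
    and W: "W = Max (w ` {1..k})"
    and R: "R = Max (r ` {1..k})"
    and S: "S = S_sg k r"
    and d: "d = Gcd (r ` {2..k})"
    and P: "P = P_sg k w r n"
    and d_pos: "d > 0"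
    and numerical: "coprime n d"
    and n_large: "n > W * R ^ 2"
  shows "Apery P n = {i + min_wlen k w r i * n | i. i \<in> Apery S (d * n)} \<and>
         (\<forall>i \<in> Apery S (d * n). wlen_set k w r n (i + min_wlen k w r i * n) = {min_wlen k w r i})"
proof -
  let ?m = "min_wlen k w r"
  have W_ge: "w j \<le> W" and R_ge: "r j \<le> R" if "j \<in> {1..k}" for j
    using that by (auto simp: W R)
  have ratio: "w k * r j \<le> r k * w j" if "j \<in> {2..k}" for j
  proof -
    have "real (r j) / real (w j) \<le> real (r k) / real (w k)" using ordered[of j k] that by auto
    moreover have "w j > 0" "w k > 0" using w_pos[of j] w_pos[of k] that by auto
    ultimately have "real (w k * r j) \<le> real (r k * w j)" by (simp add: field_simps)
    then show ?thesis by linarith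
  qed
  have "\<exists>j\<in>{2..k}. r j > 0"
  proof (rule ccontr)
    assume "\<not> ?thesis"
    then have "r ` {2..k} \<subseteq> {0}" by auto
    then show False using d d_pos Gcd_0_iff by (metis less_irrefl)
  qed
  then obtain j where j: "j \<in> {2..k}" "r j > 0" by blast
  have k2: "k \<ge> 2" and kk: "k \<in> {1..k}" using j k by auto
  have wk: "w k > 0" using w_pos[OF kk] by simp
  have rk: "r k > 0" using ratio[OF j(1)] j(2) wk by (metis gr0I mult_0 mult_is_0 not_le zero_less_iff_neq_zero)
  have "W > 0" using W_ge[OF kk] wk by simp
  have n_pos: "n > 0" using n_large by simp
  have "R ^ 2 \<le> W * R ^ 2" using \<open>W > 0\<close> by simp
  moreover have "n \<le> d * n" using d_pos by simp
  ultimately have "R ^ 2 \<le> d * n" using n_large by linarith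
  then have dn: "d * n \<in> S"
    unfolding S d by (intro large_multiple_in_S k2 rk) (auto intro!: R_ge)
  have "W * r k ^ 2 \<le> W * R ^ 2" using R_ge[OF kk] by (intro mult_le_mono2 power_mono) auto
  then have n_gt: "W * r k ^ 2 < n" using n_large by (rule le_less_trans)
  have less: "?m i < ?m i'" if "i \<in> S" "i' \<in> S" "i + n \<le> i'" for i i'
    by (rule min_wlen_less[of k r w, OF k2 rk wk _ ratio n_gt]) (use that W_ge S in auto)

  note P_iff = P_sg_iff[of k w, OF k w1, of _ r n, folded P S]
  \<comment> \<open>A representation of the candidate element with a second pair \<open>(i', l)\<close> is impossible; this gives
    both the uniqueness of lengths and one of the two inclusions.\<close>
  have unique: "i' = i \<and> l = ?m i"
    if i: "i \<in> Apery S (d * n)" and i': "i' \<in> S" "?m i' \<le> l" and eq: "i + ?m i * n = i' + l * n"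
    for i i' l
  proof -
    have iS: "i \<in> S" and not: "\<And>s. s \<in> S \<Longrightarrow> i \<noteq> s + d * n" using i by (auto simp: Apery_iff)
    have "\<not> i < i'"
    proof
      assume "i < i'"
      then have "l * n < ?m i * n" using eq by linarith
      then have lt: "l < ?m i" by simp
      then have "i' = i + (?m i - l) * n" using eq by (simp add: diff_mult_distrib)
      moreover have "1 * n \<le> (?m i - l) * n" using lt by (intro mult_le_mono1) simp
      ultimately have "?m i < ?m i'" using less[OF iS i'(1)] by simp
      then show False using lt i'(2) by simp
    qed
    moreover have "\<not> i' < i"
    proof
      assume lt: "i' < i"
      have "i - i' = (l - ?m i) * n" using eq by (simp add: diff_mult_distrib)
      then have "n dvd i - i'" by simp
      moreover have "d dvd i - i'"
        using Gcd_dvd_S_sg iS i'(1) unfolding S d by (intro dvd_diff_nat) blast+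
      ultimately have "d * n dvd i - i'"
        using numerical by (intro divides_mult) (auto simp: coprime_commute)
      then obtain t where t: "i - i' = d * n * t" by (rule dvdE)
      with lt obtain t' where "t = Suc t'" by (cases t) auto
      then have "i = (i' + t' * (d * n)) + d * n" using t lt by (simp add: algebra_simps)
      moreover have "i' + t' * (d * n) \<in> S" using i'(1) dn unfolding S by (rule S_sg_add_multiple)
      ultimately show False using not by blast
    qed
    ultimately have "i' = i" by simp
    then show ?thesis using eq n_pos by simp
  qed

  have "Apery P n = {i + ?m i * n | i. i \<in> Apery S (d * n)}" (is "_ = ?A")
  proof
    show "Apery P n \<subseteq> ?A"
    proof
      fix a assume "a \<in> Apery P n"
      then have aP: "a \<in> P" and not: "\<And>s. s \<in> P \<Longrightarrow> a \<noteq> s + n" by (auto simp: Apery_iff)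
      obtain i l where il: "i \<in> S" "l \<ge> ?m i" "a = i + l * n" using aP P_iff by blast
      have l: "l = ?m i"
      proof (rule ccontr)
        assume "l \<noteq> ?m i"
        then obtain l' where l': "l = Suc l'" "l' \<ge> ?m i" using il(2) by (cases l) auto
        then have "i + l' * n \<in> P" using il(1) P_iff by blast
        then show False using not[of "i + l' * n"] il(3) l' by simp
      qed
      have "i \<noteq> s + d * n" if s: "s \<in> S" for s
      proof
        assume eq: "i = s + d * n"
        \<comment> \<open>Trading \<open>d * n\<close> for \<open>d\<close> copies of \<open>n\<close> leaves length \<open>?m i + d - 1\<close> for \<open>s\<close> after
          removing one \<open>n\<close>.\<close>
        have "?m s < ?m i" using less[OF s il(1)] eq \<open>n \<le> d * n\<close> by simp
        then have "s + (?m i + d - 1) * n \<in> P" using s d_pos P_iff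
          by (metis Nat.add_diff_assoc Suc_leI add.commute le_add2 less_imp_le order_trans One_nat_def)
        moreover have "a = (s + (?m i + d - 1) * n) + n"
          using eq il(3) l d_pos by (cases d) (auto simp: algebra_simps)
        ultimately show False using not by blast
      qed
      then show "a \<in> ?A" using il l by (auto simp: Apery_iff)
    qed
  next
    show "?A \<subseteq> Apery P n"
    proof
      fix a assume "a \<in> ?A"
      then obtain i where i: "i \<in> Apery S (d * n)" "a = i + ?m i * n" by blast
      then have "a \<in> P" using P_iff by (auto simp: Apery_iff)
      moreover have "a \<noteq> s + n" if s: "s \<in> P" for s
      proof
        assume eq: "a = s + n"
        obtain i' l where il: "i' \<in> S" "l \<ge> ?m i'" "s = i' + l * n" using s P_iff by blast
        then have "i' = i \<and> Suc l = ?m i" using i eq by (intro unique) auto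
        then show False using il(2) by simp
      qed
      ultimately show "a \<in> Apery P n" by (auto simp: Apery_iff)
    qed
  qed
  moreover have "wlen_set k w r n (i + ?m i * n) = {?m i}" if i: "i \<in> Apery S (d * n)" for i
  proof -
    have "l \<in> wlen_set k w r n (i + ?m i * n) \<longleftrightarrow> l = ?m i" for l
      unfolding wlen_set_iff[of k w, OF k w1] S[symmetric]
      using unique[OF i] i by (auto simp: Apery_iff)
    then show ?thesis by blast
  qed
  ultimately show ?thesis by blast
qed

end
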